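(* For every measurable set $X\in\mathcal B$, $\|\pi_X\|_\mu^2=\mu(X)$.
   Context: $(\mathcal X,\mathcal B,\mu)$ is a probability measure space and $\mathcal H=L^2(\mathcal X,\mu)$ (complex-valued) with $\langle f,g\rangle=\int_{\mathcal X} f\overline g\,d\mu$. For $X\in\mathcal B$, $\pi_X:\mathcal H\to\mathcal H$ is the orthogonal projector $\pi_Xf=\mathbf 1_X f$. A partition is a finite family $\chi=\{Y_1,\dots,Y_J\}\subset\mathcal B$ with $\mu(\mathcal X\setminus\bigcup_j Y_j)=0$ and $\mu(Y_j\cap Y_k)=0$ for $j\ne k$. For a bounded operator $W$ on $\mathcal H$ with operator norm $\|W\|$, put $\mathcal M_\chi(W)=\sum_{j=1}^J\mu(Y_j)\|W\pi_{Y_j}\|^2$, and define the $\mu$-norm $\|W\|_\mu=\inf_\chi\sqrt{\mathcal M_\chi(W)}$, the infimum being over all partitions $\chi$. *)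

theory Defs
  imports "HOL-Probability.Probability"
begin

text \<open>Since the measure is a variable, the Hilbert space \<open>L\<^sup>2(M)\<close> cannot be a type. It is the set
  \<open>L2_space M\<close> of classes of square-integrable functions modulo equality almost everywhere, and
  operators are functions on classes, of which only the values on \<open>L2_space M\<close> matter.\<close>

definition square_integrable :: "'a measure \<Rightarrow> ('a \<Rightarrow> complex) set" where
  "square_integrable M =
     {f \<in> borel_measurable M. integrable M (\<lambda>x. (cmod (f x))\<^sup>2)}"

definition ae_eq :: "'a measure \<Rightarrow> (('a \<Rightarrow> complex) \<times> ('a \<Rightarrow> complex)) set" where
  "ae_eq M = {(f, g). f \<in> square_integrable M \<and> g \<in> square_integrable M \<and> (AE x in M. f x = g x)}"

definition L2_space :: "'a measure \<Rightarrow> ('a \<Rightarrow> complex) set set" where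
  "L2_space M = square_integrable M // ae_eq M"

definition L2_class :: "'a measure \<Rightarrow> ('a \<Rightarrow> complex) \<Rightarrow> ('a \<Rightarrow> complex) set" where
  "L2_class M f = ae_eq M `` {f}"

definition L2_rep :: "('a \<Rightarrow> complex) set \<Rightarrow> 'a \<Rightarrow> complex" where
  "L2_rep F = (SOME f. f \<in> F)"

definition L2_inner :: "'a measure \<Rightarrow> ('a \<Rightarrow> complex) set \<Rightarrow> ('a \<Rightarrow> complex) set \<Rightarrow> complex" where
  "L2_inner M F G = (LINT x|M. L2_rep F x * cnj (L2_rep G x))"

definition L2_norm :: "'a measure \<Rightarrow> ('a \<Rightarrow> complex) set \<Rightarrow> real" where
  "L2_norm M F = sqrt (Re (L2_inner M F F))"

text \<open>The supremum is taken in \<open>real\<close>, so this is the operator norm for bounded operators only.\<close>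

definition op_norm ::
  "'a measure \<Rightarrow> (('a \<Rightarrow> complex) set \<Rightarrow> ('a \<Rightarrow> complex) set) \<Rightarrow> real" where
  "op_norm M W = Sup {L2_norm M (W F) | F. F \<in> L2_space M \<and> L2_norm M F \<le> 1}"

definition ind_proj :: "'a measure \<Rightarrow> 'a set \<Rightarrow> ('a \<Rightarrow> complex) set \<Rightarrow> ('a \<Rightarrow> complex) set" where
  "ind_proj M X F = L2_class M (\<lambda>x. indicator X x * L2_rep F x)"

text \<open>A family is indexed by \<open>{1..J}\<close>; null sets may be members and may be repeated.\<close>

definition ae_partition :: "'a measure \<Rightarrow> nat \<Rightarrow> (nat \<Rightarrow> 'a set) \<Rightarrow> bool" where
  "ae_partition M J Y \<longleftrightarrow>
     (\<forall>j\<in>{1..J}. Y j \<in> sets M) \<and>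
     measure M (space M - (\<Union>j\<in>{1..J}. Y j)) = 0 \<and>
     (\<forall>j\<in>{1..J}. \<forall>k\<in>{1..J}. j \<noteq> k \<longrightarrow> measure M (Y j \<inter> Y k) = 0)"

definition partition_sum ::
  "'a measure \<Rightarrow> nat \<Rightarrow> (nat \<Rightarrow> 'a set) \<Rightarrow>
   (('a \<Rightarrow> complex) set \<Rightarrow> ('a \<Rightarrow> complex) set) \<Rightarrow> real" where
  "partition_sum M J Y W =
     (\<Sum>j=1..J. measure M (Y j) * (op_norm M (W \<circ> ind_proj M (Y j)))\<^sup>2)"

definition mu_norm ::
  "'a measure \<Rightarrow> (('a \<Rightarrow> complex) set \<Rightarrow> ('a \<Rightarrow> complex) set) \<Rightarrow> real" where
  "mu_norm M W = Inf {sqrt (partition_sum M J Y W) | J Y. ae_partition M J Y}"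

text \<open>The choice of representatives above is immaterial.\<close>

lemma equiv_ae_eq: "equiv (square_integrable M) (ae_eq M)"
  by (rule equivI) (auto simp: ae_eq_def intro!: refl_onI symI transI elim: AE_mp)

lemma L2_rep_class:
  assumes "f \<in> square_integrable M"
  shows "L2_rep (L2_class M f) \<in> square_integrable M"
    and "AE x in M. L2_rep (L2_class M f) x = f x"
proof -
  have "f \<in> L2_class M f"
    using assms by (simp add: L2_class_def ae_eq_def)
  then have "L2_rep (L2_class M f) \<in> L2_class M f"
    unfolding L2_rep_def by (rule someI[where P = "\<lambda>h. h \<in> L2_class M f"])
  then show "L2_rep (L2_class M f) \<in> square_integrable M"
    and "AE x in M. L2_rep (L2_class M f) x = f x"
    by (auto simp: L2_class_def ae_eq_def elim: AE_mp)
qed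

lemma L2_inner_class:
  assumes f: "f \<in> square_integrable M" and g: "g \<in> square_integrable M"
  shows "L2_inner M (L2_class M f) (L2_class M g) = (LINT x|M. f x * cnj (g x))"
  unfolding L2_inner_def
proof (rule integral_cong_AE)
  have [measurable]: "cnj \<in> borel_measurable borel"
    by (intro borel_measurable_continuous_onI continuous_intros)
  note meas [measurable] = L2_rep_class(1)[OF f, unfolded square_integrable_def, simplified, THEN conjunct1]
    L2_rep_class(1)[OF g, unfolded square_integrable_def, simplified, THEN conjunct1]
    f[unfolded square_integrable_def, simplified, THEN conjunct1]
    g[unfolded square_integrable_def, simplified, THEN conjunct1]
  show "(\<lambda>x. L2_rep (L2_class M f) x * cnj (L2_rep (L2_class M g) x)) \<in> borel_measurable M"
    by measurable
  show "(\<lambda>x. f x * cnj (g x)) \<in> borel_measurable M"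
    by measurable
  show "AE x in M. L2_rep (L2_class M f) x * cnj (L2_rep (L2_class M g) x) = f x * cnj (g x)"
    using L2_rep_class(2)[OF f] L2_rep_class(2)[OF g] by eventually_elim simp
qed

lemma indicator_square_integrable:
  assumes f: "f \<in> square_integrable M" and X: "X \<in> sets M"
  shows "(\<lambda>x. indicator X x * f x) \<in> square_integrable M"
proof -
  have [measurable]: "f \<in> borel_measurable M" "X \<in> sets M"
    and int: "integrable M (\<lambda>x. (cmod (f x))\<^sup>2)"
    using f X by (auto simp: square_integrable_def)
  have "integrable M (\<lambda>x. (cmod (indicator X x * f x))\<^sup>2)"
    by (rule Bochner_Integration.integrable_bound[OF int]) (auto simp: indicator_def)
  then show ?thesis
    by (simp add: square_integrable_def)
qed

lemma ind_proj_class: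
  assumes f: "f \<in> square_integrable M" and X: "X \<in> sets M"
  shows "ind_proj M X (L2_class M f) = L2_class M (\<lambda>x. indicator X x * f x)"
proof -
  have "AE x in M. indicator X x * L2_rep (L2_class M f) x = indicator X x * f x"
    using L2_rep_class(2)[OF f] by eventually_elim simp
  then have "((\<lambda>x. indicator X x * L2_rep (L2_class M f) x), (\<lambda>x. indicator X x * f x)) \<in> ae_eq M"
    using indicator_square_integrable[OF L2_rep_class(1)[OF f] X] indicator_square_integrable[OF f X]
    by (simp add: ae_eq_def)
  then show ?thesis
    unfolding ind_proj_def L2_class_def by (rule equiv_class_eq[OF equiv_ae_eq])
qed

end

theory Submission
  imports Defs
begin

text \<open>The composite of the projectors on \<open>X\<close> and \<open>Y\<close> is the projector on \<open>X \<inter> Y\<close>, whose norm is 1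
  unless \<open>X \<inter> Y\<close> is a null set, when it is 0. A partition sum for the projector on \<open>X\<close> is
  therefore the total measure of the blocks meeting \<open>X\<close> in positive measure; these cover \<open>X\<close> up to
  a null set, so the sum is at least the measure of \<open>X\<close>. The partition into \<open>X\<close> and its complement
  attains this bound.\<close>

text \<open>The integrand of the inner product of a class with itself is the real function
  \<open>(cmod (f x))\<^sup>2\<close>, so taking the real part loses nothing, and later estimates
  become estimates of real integrals.\<close>

lemma L2_norm_class:
  assumes "f \<in> square_integrable M"
  shows "L2_norm M (L2_class M f) = sqrt (LINT x|M. (cmod (f x))\<^sup>2)"
proof -
  have "f x * cnj (f x) = complex_of_real ((cmod (f x))\<^sup>2)" for x
    by (rule complex_norm_square[symmetric])
  then have "L2_inner M (L2_class M f) (L2_class M f) = of_real (LINT x|M. (cmod (f x))\<^sup>2)"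
    unfolding L2_inner_class[OF assms assms] by (simp only: integral_complex_of_real)
  then show ?thesis
    by (simp add: L2_norm_def)
qed

lemma L2_space_cases:
  assumes "F \<in> L2_space M"
  obtains f where "f \<in> square_integrable M" "F = L2_class M f"
  using assms unfolding L2_space_def L2_class_def by (elim quotientE)

lemma L2_class_in_L2_space: "f \<in> square_integrable M \<Longrightarrow> L2_class M f \<in> L2_space M"
  unfolding L2_space_def L2_class_def by (rule quotientI)

lemma ind_proj_comp:
  assumes "F \<in> L2_space M" "X \<in> sets M" "Y \<in> sets M"
  shows "(ind_proj M X \<circ> ind_proj M Y) F = ind_proj M (X \<inter> Y) F"
  using assms(1)
  by (rule L2_space_cases)
     (simp add: assms(2,3) ind_proj_class indicator_square_integrable indicator_inter_arith
       sets.Int mult.assoc)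

text \<open>The supremum only sees arguments in \<open>L2_space M\<close>. This makes the
  composition law usable, since it holds for classes and not for arbitrary sets of
  functions.\<close>

lemma op_norm_cong:
  assumes "\<And>F. F \<in> L2_space M \<Longrightarrow> V F = W F"
  shows "op_norm M V = op_norm M W"
  unfolding op_norm_def by (intro arg_cong[where f = Sup] Collect_cong) (metis assms)

lemma L2_norm_ind_proj:
  assumes f: "f \<in> square_integrable M" and Z: "Z \<in> sets M"
  shows "L2_norm M (ind_proj M Z (L2_class M f)) = sqrt (LINT x|M. indicator Z x * (cmod (f x))\<^sup>2)"
proof -
  have "(cmod (indicator Z x * f x))\<^sup>2 = indicator Z x * (cmod (f x))\<^sup>2" for x
    by (simp add: indicator_def)
  then show ?thesis
    by (simp add: ind_proj_class[OF assms] L2_norm_class indicator_square_integrable[OF assms])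
qed

lemma L2_norm_ind_proj_le:
  assumes F: "F \<in> L2_space M" and Z: "Z \<in> sets M"
  shows "L2_norm M (ind_proj M Z F) \<le> L2_norm M F"
  using F
proof (rule L2_space_cases)
  fix f assume f: "f \<in> square_integrable M" and "F = L2_class M f"
  moreover have "(LINT x|M. indicator Z x * (cmod (f x))\<^sup>2) \<le> (LINT x|M. (cmod (f x))\<^sup>2)"
    using f by (intro integral_mono') (auto simp: square_integrable_def indicator_def)
  ultimately show ?thesis
    by (simp add: L2_norm_ind_proj Z L2_norm_class)
qed

lemma op_norm_ind_proj_null:
  assumes Z: "Z \<in> null_sets M"
  shows "op_norm M (ind_proj M Z) = 0"
proof -
  have zero: "(\<lambda>x. 0) \<in> square_integrable M"
    by (simp add: square_integrable_def)
  have norm0: "L2_norm M (ind_proj M Z F) = 0" if "F \<in> L2_space M" for F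
    using that
  proof (rule L2_space_cases)
    fix f assume f: "f \<in> square_integrable M" and F: "F = L2_class M f"
    have "AE x in M. indicator Z x * (cmod (f x))\<^sup>2 = 0"
      using AE_not_in[OF Z] by eventually_elim simp
    then have "(LINT x|M. indicator Z x * (cmod (f x))\<^sup>2) = 0"
      by (rule integral_eq_zero_AE)
    then show ?thesis
      using Z by (simp add: F L2_norm_ind_proj f null_setsD2)
  qed
  \<comment> \<open>The zero class lies in the unit ball, so the set of norms is nonempty and hence
    exactly \<open>{0}\<close>.\<close>
  have "L2_norm M (L2_class M (\<lambda>x. 0)) \<le> 1"
    by (simp add: L2_norm_class zero)
  then have "{L2_norm M (ind_proj M Z F) | F. F \<in> L2_space M \<and> L2_norm M F \<le> 1} = {0}"
    using norm0 L2_class_in_L2_space[OF zero] by (auto intro!: exI[of _ "L2_class M (\<lambda>x. 0)"])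
  then show ?thesis
    by (simp add: op_norm_def)
qed

text \<open>A projector is a contraction, and the normalised indicator of \<open>Z\<close> is a unit
  vector that keeps its norm, so the bound 1 is attained.\<close>

lemma op_norm_ind_proj:
  assumes Z: "Z \<in> sets M" and pos: "measure M Z > 0"
  shows "op_norm M (ind_proj M Z) = 1"
proof -
  \<comment> \<open>The real-valued \<open>measure\<close> is 0 on sets of infinite measure, so
    positivity forces finiteness.\<close>
  have fin: "emeasure M Z < \<infinity>"
    using pos by (metis infinity_ennreal_def less_irrefl measure_def enn2real_top top.not_eq_extremum)
  define f where "f = (\<lambda>x. complex_of_real (indicator Z x / sqrt (measure M Z)))"
  have eq: "(cmod (f x))\<^sup>2 = indicator Z x / measure M Z"
    and eq': "indicator Z x * (cmod (f x))\<^sup>2 = indicator Z x / measure M Z" for x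
    using pos by (simp_all add: f_def indicator_def norm_divide power_divide)
  have "f \<in> borel_measurable M"
    using Z by (simp add: f_def)
  then have f: "f \<in> square_integrable M"
    using Z fin by (simp add: square_integrable_def eq)
  have int: "(LINT x|M. indicator Z x / measure M Z) = 1"
    using Z pos fin by simp
  have norms: "L2_norm M (L2_class M f) = 1" "L2_norm M (ind_proj M Z (L2_class M f)) = 1"
    unfolding L2_norm_class[OF f] L2_norm_ind_proj[OF f Z] eq' unfolding eq int by simp_all
  show ?thesis
    unfolding op_norm_def
  proof (rule cSup_eq_maximum)
    show "1 \<in> {L2_norm M (ind_proj M Z F) | F. F \<in> L2_space M \<and> L2_norm M F \<le> 1}"
      using norms L2_class_in_L2_space[OF f] by (auto intro!: exI[of _ "L2_class M f"])
    show "c \<le> 1" if "c \<in> {L2_norm M (ind_proj M Z F) | F. F \<in> L2_space M \<and> L2_norm M F \<le> 1}" for c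
      using that L2_norm_ind_proj_le[OF _ Z] by force
  qed
qed

context prob_space
begin

text \<open>In a probability space \<open>prob\<close> vanishes only on null sets, so the null case
  and the positive case are exhaustive.\<close>

lemma op_norm_ind_proj_comp:
  assumes "X \<in> events" "Y \<in> events"
  shows "op_norm M (ind_proj M X \<circ> ind_proj M Y) = of_bool (prob (X \<inter> Y) \<noteq> 0)"
proof -
  have "op_norm M (ind_proj M X \<circ> ind_proj M Y) = op_norm M (ind_proj M (X \<inter> Y))"
    using assms by (intro op_norm_cong ind_proj_comp)
  then show ?thesis
    using assms op_norm_ind_proj[of "X \<inter> Y" M] op_norm_ind_proj_null[of "X \<inter> Y" M]
    by (auto simp: zero_less_measure_iff null_sets_def emeasure_eq_measure sets.Int)
qed

text \<open>The operator norms are 0 or 1 and thus equal their squares.\<close>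

lemma partition_sum_ind_proj:
  assumes "X \<in> events" "ae_partition M J Y"
  shows "partition_sum M J Y (ind_proj M X) =
    (\<Sum>j=1..J. prob (Y j) * of_bool (prob (X \<inter> Y j) \<noteq> 0))"
  unfolding partition_sum_def
  using assms by (intro sum.cong) (auto simp: op_norm_ind_proj_comp ae_partition_def)

lemma partition_sum_ind_proj_ge:
  assumes X: "X \<in> events" and Y: "ae_partition M J Y"
  shows "prob X \<le> partition_sum M J Y (ind_proj M X)"
proof -
  have ev: "Y j \<in> events" if "j \<in> {1..J}" for j
    using Y that by (simp add: ae_partition_def)
  have U: "(\<Union>j\<in>{1..J}. Y j) \<in> events" "(\<Union>j\<in>{1..J}. X \<inter> Y j) \<in> events"
    using ev X by auto
  \<comment> \<open>A point of \<open>X\<close> outside all blocks lies in the leftover set, which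
    is null.\<close>
  have "prob X \<le> prob ((space M - (\<Union>j\<in>{1..J}. Y j)) \<union> (\<Union>j\<in>{1..J}. X \<inter> Y j))"
    using U sets.sets_into_space[OF X] by (intro finite_measure_mono) auto
  also have "\<dots> \<le> prob (space M - (\<Union>j\<in>{1..J}. Y j)) + prob (\<Union>j\<in>{1..J}. X \<inter> Y j)"
    using U by (intro measure_Un_le) auto
  also have "\<dots> = prob (\<Union>j\<in>{1..J}. X \<inter> Y j)"
    using Y by (simp add: ae_partition_def)
  also have "\<dots> \<le> (\<Sum>j=1..J. prob (X \<inter> Y j))"
    using ev X by (intro finite_measure_subadditive_finite) auto
  \<comment> \<open>Termwise: a null intersection contributes 0 on both sides; otherwise the factor
    is 1 and monotonicity applies.\<close>
  also have "\<dots> \<le> (\<Sum>j=1..J. prob (Y j) * of_bool (prob (X \<inter> Y j) \<noteq> 0))"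
    using ev by (intro sum_mono) (auto intro!: finite_measure_mono)
  finally show ?thesis
    by (simp add: partition_sum_ind_proj[OF X Y])
qed

lemma mu_norm_ind_proj:
  assumes X: "X \<in> events"
  shows "mu_norm M (ind_proj M X) = sqrt (prob X)"
  unfolding mu_norm_def
proof (rule cInf_eq_minimum)
  define Y where "Y = (\<lambda>j::nat. if j = 1 then X else space M - X)"
  have two: "{1..2} = {1, 2::nat}"
    by auto
  have sum_two: "(\<Sum>j=1..2. g j) = g 1 + g 2" for g :: "nat \<Rightarrow> real"
    unfolding two by simp
  have disj: "X \<inter> (space M - X) = {}" "(space M - X) \<inter> X = {}"
    by auto
  have Y: "ae_partition M 2 Y"
    unfolding ae_partition_def two using X by (simp add: Y_def disj sets.sets_into_space Un_absorb2)
  \<comment> \<open>The complement does not meet \<open>X\<close> and drops out; the block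
    \<open>X\<close> contributes \<open>prob X\<close> even when this is 0.\<close>
  have "partition_sum M 2 Y (ind_proj M X) = prob X"
    unfolding partition_sum_ind_proj[OF X Y] sum_two by (simp add: Y_def disj)
  with Y show "sqrt (prob X) \<in> {sqrt (partition_sum M J Y (ind_proj M X)) | J Y. ae_partition M J Y}"
    by (auto intro!: exI[of _ 2] exI[of _ Y])
  show "sqrt (prob X) \<le> c"
    if "c \<in> {sqrt (partition_sum M J Y (ind_proj M X)) | J Y. ae_partition M J Y}" for c
    using that partition_sum_ind_proj_ge[OF X] by auto
qed

end

theorem lemma2p1:
  fixes M :: "'a measure" and X :: "'a set"
  assumes "prob_space M"
    and "X \<in> sets M"
  shows "(mu_norm M (ind_proj M X))\<^sup>2 = measure M X"
  using prob_space.mu_norm_ind_proj[OF assms] by simp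

end
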